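(* Let $n\geqslant 2$ be an integer, and set $a_n=2(n-1)\sin^2(\pi/(2n))$ and $b_n=6(n-1)^2\sin^4(\pi/(2n))$. Then for all $c\in[0,1]$, $$f_n(c)\leqslant\frac{1}{\sqrt{1+4(n-1)\sin^2(\pi/(2n))\,(1-c)}}\leqslant 1-a_n(1-c)+b_n(1-c)^2.$$
   Context: For closed subspaces $H_1,\dots,H_n$ ($n\geqslant 2$) of a complex Hilbert space $H$, put $H_0:=H_1\cap\dots\cap H_n$ and let $P_k$ be the orthogonal projection of $H$ onto $H_k$, $k=0,1,\dots,n$. The Friedrichs number is $$c_F(H_1,\dots,H_n):=\sup\left\{\frac{2}{n-1}\frac{\sum_{i<j}\mathrm{Re}\langle x_i,x_j\rangle}{\|x_1\|^2+\dots+\|x_n\|^2}\,:\, x_i\in H_i\ominus H_0,\ i=1,\dots,n,\ (x_1,\dots,x_n)\neq(0,\dots,0)\right\},$$ where $H_i\ominus H_0$ is the orthogonal complement of $H_0$ in $H_i$ (if all $H_i=H_0$, the supremum is over the empty set and is taken to be $0$). For $c\in[0,1]$, $$f_n(c):=\sup\{\|P_n\cdots P_2P_1-P_0\|\,:\, c_F(H_1,\dots,H_n)\leqslant c\},$$ the supremum being over all complex Hilbert spaces $H$ and all systems of closed subspaces $H_1,\dots,H_n$ of $H$ with $c_F(H_1,\dots,H_n)\leqslant c$. *)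

theory Defs
  imports "HOL-Analysis.Analysis"
begin

text \<open>The norm, topology and completeness of a complex Hilbert space are those of the underlying
  real Hilbert space, whose inner product is the real part of the complex one.\<close>

class complex_hilbert_space = real_inner + complete_space +
  fixes scaleC :: "complex \<Rightarrow> 'a \<Rightarrow> 'a"
    and cinner :: "'a \<Rightarrow> 'a \<Rightarrow> complex"
  assumes scaleC_add_right: "scaleC a (x + y) = scaleC a x + scaleC a y"
    and scaleC_add_left: "scaleC (a + b) x = scaleC a x + scaleC b x"
    and scaleC_scaleC: "scaleC a (scaleC b x) = scaleC (a * b) x"
    and scaleC_of_real: "scaleC (complex_of_real r) x = scaleR r x"
    and cinner_commute: "cinner x y = cnj (cinner y x)"
    and cinner_add_left: "cinner (x + y) z = cinner x z + cinner y z"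
    and cinner_scaleC_left: "cinner (scaleC a x) y = a * cinner x y"
    and Re_cinner: "Re (cinner x y) = inner x y"

instantiation complex :: complex_hilbert_space
begin

definition scaleC_complex :: "complex \<Rightarrow> complex \<Rightarrow> complex"
  where "scaleC_complex a x = a * x"

definition cinner_complex :: "complex \<Rightarrow> complex \<Rightarrow> complex"
  where "cinner_complex x y = x * cnj y"

instance
  by standard
    (auto simp: scaleC_complex_def cinner_complex_def inner_complex_def algebra_simps
      scaleR_conv_of_real)

end

global_interpretation complex_vector:
  vector_space "scaleC :: complex \<Rightarrow> 'a \<Rightarrow> 'a :: complex_hilbert_space"
proof
  show "scaleC 1 x = x" for x :: 'a
    using scaleC_of_real[of 1 x] by simp
qed (simp_all add: scaleC_add_right scaleC_add_left scaleC_scaleC)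

definition closed_csubspace :: "'a::complex_hilbert_space set \<Rightarrow> bool"
  where "closed_csubspace S \<longleftrightarrow> complex_vector.subspace S \<and> closed S"

definition orth_proj :: "'a::complex_hilbert_space set \<Rightarrow> 'a \<Rightarrow> 'a"
  where "orth_proj S x = (THE p. p \<in> S \<and> (\<forall>y\<in>S. cinner (x - p) y = 0))"

definition ominus :: "'a::complex_hilbert_space set \<Rightarrow> 'a set \<Rightarrow> 'a set"  (infixl "\<ominus>" 65)
  where "S \<ominus> T = {x \<in> S. \<forall>y\<in>T. cinner x y = 0}"

text \<open>A system of \<open>n\<close> subspaces is a function \<open>H\<close> on \<open>nat\<close> of which only the
  values \<open>H 1, \<dots>, H n\<close> are used; in particular \<open>H 0\<close> plays no role, and the
  intersection of the system is \<open>Hcap n H\<close>.\<close>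

definition Hcap :: "nat \<Rightarrow> (nat \<Rightarrow> 'a set) \<Rightarrow> 'a set"
  where "Hcap n H = (\<Inter>i\<in>{1..n}. H i)"

definition friedrichs_set :: "nat \<Rightarrow> (nat \<Rightarrow> 'a::complex_hilbert_space set) \<Rightarrow> real set"
  where "friedrichs_set n H =
    {2 / (real n - 1) *
       ((\<Sum>(i, j)\<in>{(i, j). 1 \<le> i \<and> i < j \<and> j \<le> n}. Re (cinner (x i) (x j)))
        / (\<Sum>i=1..n. (norm (x i))\<^sup>2)) | x.
     (\<forall>i\<in>{1..n}. x i \<in> H i \<ominus> Hcap n H) \<and> (\<exists>i\<in>{1..n}. x i \<noteq> 0)}"

definition friedrichs_number :: "nat \<Rightarrow> (nat \<Rightarrow> 'a::complex_hilbert_space set) \<Rightarrow> real"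
  where "friedrichs_number n H =
    (if friedrichs_set n H = {} then 0 else Sup (friedrichs_set n H))"

primrec proj_product :: "(nat \<Rightarrow> 'a::complex_hilbert_space set) \<Rightarrow> nat \<Rightarrow> 'a \<Rightarrow> 'a"
  where
    "proj_product H 0 = id"
  | "proj_product H (Suc k) = orth_proj (H (Suc k)) \<circ> proj_product H k"

text \<open>A HOL term cannot range over all types, so the supremum defining \<open>f\<^sub>n(c)\<close> is taken over
  the systems of closed subspaces of the Hilbert space \<open>'a\<close>, and the supremum over all Hilbert
  spaces is the supremum over all \<open>'a\<close>: a bound on it is a bound that holds for every \<open>'a\<close>.
  A Hilbert space isometric to a closed subspace of \<open>'a\<close> contributes no further values, since
  all the projections vanish on the orthogonal complement of that subspace.\<close>

definition friedrichs_f :: "'a::complex_hilbert_space itself \<Rightarrow> nat \<Rightarrow> real \<Rightarrow> real"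
  where "friedrichs_f (_ :: 'a itself) n c =
    Sup {onorm (\<lambda>x. proj_product H n x - orth_proj (Hcap n H) x) | H :: nat \<Rightarrow> 'a set.
      (\<forall>i\<in>{1..n}. closed_csubspace (H i)) \<and> friedrichs_number n H \<le> c}"

definition coeff_a :: "nat \<Rightarrow> real"
  where "coeff_a n = 2 * (real n - 1) * (sin (pi / (2 * real n)))\<^sup>2"

definition coeff_b :: "nat \<Rightarrow> real"
  where "coeff_b n = 6 * (real n - 1)\<^sup>2 * (sin (pi / (2 * real n))) ^ 4"

end

theory Submission
  imports Defs
begin

text \<open>
  Fix a vector \<open>x\<close>, let \<open>p\<close> be its projection to the intersection \<open>H\<^sub>0\<close> and put
  \<open>X\<^sub>k = P\<^sub>k \<dots> P\<^sub>1 x - p\<close>. Every \<open>X\<^sub>k\<close> is orthogonal to \<open>H\<^sub>0\<close>, and \<open>X\<^sub>k\<^sub>+\<^sub>1\<close> is the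
  projection of \<open>X\<^sub>k\<close>, so Pythagoras shows that the squared steps \<open>\<parallel>X\<^sub>k\<^sub>+\<^sub>1 - X\<^sub>k\<parallel>\<^sup>2\<close> add up to
  exactly the loss \<open>\<parallel>X\<^sub>0\<parallel>\<^sup>2 - \<parallel>X\<^sub>n\<parallel>\<^sup>2\<close>. A lower bound for this loss in terms of
  \<open>\<parallel>X\<^sub>n\<parallel>\<^sup>2\<close> is therefore a bound on the product of the projections.

  The system \<open>X\<^sub>1, \<dots>, X\<^sub>n\<close> is admissible in the definition of the Friedrichs number. A small
  Friedrichs number says that its sum is short, that is, that the vectors are far
  from their common mean: the total squared deviation from the mean is at least
  \<open>(n - 1) (1 - c) / n\<close> times \<open>\<Sum> \<parallel>X\<^sub>i\<parallel>\<^sup>2\<close> (lemma \<open>norm_sum_le_friedrichs_number\<close>), and this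
  last sum is at least \<open>n \<parallel>X\<^sub>n\<parallel>\<^sup>2\<close> since the norms decrease. A path of \<open>n\<close> points that
  deviates from its mean must take steps: by the discrete Wirtinger inequality
  (lemma \<open>neumann_wirtinger\<close>) the squared steps sum to at least \<open>4 sin\<^sup>2 (\<pi> / 2n)\<close> times the
  deviation. The constant is the smallest positive eigenvalue of the Laplacian of the path with
  \<open>n\<close> vertices. Together this gives
  \<open>\<parallel>X\<^sub>0\<parallel>\<^sup>2 \<ge> (1 + 4 (n - 1) sin\<^sup>2 (\<pi> / 2n) (1 - c)) \<parallel>X\<^sub>n\<parallel>\<^sup>2\<close> (lemma \<open>proj_product_bound\<close>).

  The second inequality of the theorem compares \<open>1 / sqrt (1 + 2 t)\<close> with its second Taylor
  polynomial at \<open>t = a\<^sub>n (1 - c)\<close>.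
\<close>

section \<open>A discrete Wirtinger inequality\<close>

text \<open>The vector \<open>\<phi> k = sin (k \<pi> / n)\<close> is the positive ground state of the second difference
  operator with zero boundary values, with eigenvalue \<open>\<mu>\<close>. Writing \<open>S = \<phi> u\<close>, each
  \<open>\<parallel>S (k+1) - S k\<parallel>\<^sup>2\<close> is a nonnegative multiple of \<open>\<parallel>u (k+1) - u k\<parallel>\<^sup>2\<close> plus
  terms \<open>h\<close>, \<open>g\<close> in the two squared norms; the eigenvalue equation collects these terms into
  \<open>\<mu> \<parallel>S k\<parallel>\<^sup>2\<close> at every point. The argument uses only inner products, so it holds for vectors
  with the same constant as for scalars.\<close>

lemma dirichlet_wirtinger:
  fixes S :: "nat \<Rightarrow> 'a::real_inner"
  assumes n: "n \<ge> 1" and S0: "S 0 = 0" and Sn: "S n = 0"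
  shows "4 * (sin (pi / (2 * real n)))\<^sup>2 * (\<Sum>k<n. (norm (S k))\<^sup>2)
           \<le> (\<Sum>k<n. (norm (S (Suc k) - S k))\<^sup>2)"
proof -
  define \<mu> where "\<mu> = 4 * (sin (pi / (2 * real n)))\<^sup>2"
  define t where "t = pi / real n"
  define \<phi> where "\<phi> k = sin (real k * t)" for k
  define g where "g k = (1 - \<phi> (Suc k) / \<phi> k) * (norm (S k))\<^sup>2" for k
  define h where "h k = (1 - \<phi> (k - 1) / \<phi> k) * (norm (S k))\<^sup>2" for k
  have pos: "\<phi> k > 0" if "0 < k" "k < n" for k
  proof -
    have "real k * pi < real n * pi"
      using that by simp
    then have "real k * t < pi"
      using that by (simp add: t_def field_simps)
    then show ?thesis
      unfolding \<phi>_def using that by (intro sin_gt_zero) (auto simp: t_def)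
  qed
  have \<phi>0: "\<phi> 0 = 0"
    by (simp add: \<phi>_def)
  have \<phi>n: "\<phi> n = 0"
    using n by (simp add: \<phi>_def t_def)
  have rec: "\<phi> (Suc (Suc k)) + \<phi> k = (2 - \<mu>) * \<phi> (Suc k)" for k
  proof -
    have "cos t = 1 - 2 * (sin (t / 2))\<^sup>2"
      using cos_double_sin[of "t / 2"] by simp
    then have "2 - \<mu> = 2 * cos t"
      by (simp add: \<mu>_def t_def mult.commute)
    moreover have "real (Suc (Suc k)) * t = real (Suc k) * t + t"
      and "real k * t = real (Suc k) * t - t"
      by (simp_all add: algebra_simps)
    ultimately show ?thesis
      unfolding \<phi>_def by (simp add: sin_add sin_diff del: of_nat_Suc)
  qed
  \<comment> \<open>At both ends \<open>\<phi>\<close> vanishes and \<open>u\<close> makes no sense; since \<open>S\<close> vanishes there too, the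
    inequality is then an equality of squared norms.\<close>
  have step: "h (Suc k) + g k \<le> (norm (S (Suc k) - S k))\<^sup>2" if k: "k < n" for k
  proof -
    have expand: "(norm (S (Suc k) - S k))\<^sup>2
        = (norm (S (Suc k)))\<^sup>2 + (norm (S k))\<^sup>2 - 2 * inner (S (Suc k)) (S k)"
      by (simp add: power2_norm_eq_inner inner_diff inner_commute)
    consider "k = 0" | "Suc k = n" | "0 < k" "Suc k < n"
      using k by linarith
    then show ?thesis
    proof cases
      case 1
      then show ?thesis
        by (simp add: h_def g_def S0 \<phi>0)
    next
      case 2
      then show ?thesis
        by (simp add: h_def g_def Sn \<phi>n)
    next
      case 3
      let ?p = "\<phi> k" and ?q = "\<phi> (Suc k)"
      have pq: "?p > 0" "?q > 0"
        using 3 pos by auto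
      have "0 \<le> ?p * ?q * (norm ((1 / ?q) *\<^sub>R S (Suc k) - (1 / ?p) *\<^sub>R S k))\<^sup>2"
        using pq by simp
      also have "\<dots> = ?p / ?q * (norm (S (Suc k)))\<^sup>2 + ?q / ?p * (norm (S k))\<^sup>2
          - 2 * inner (S (Suc k)) (S k)"
        using pq by (simp add: power2_norm_eq_inner inner_diff inner_commute field_simps)
      finally show ?thesis
        unfolding expand by (simp add: h_def g_def algebra_simps)
    qed
  qed
  have coef: "h k + g k = \<mu> * (norm (S k))\<^sup>2" if "k < n" for k
  proof (cases k)
    case 0
    then show ?thesis
      by (simp add: h_def g_def S0)
  next
    case (Suc j)
    then have "\<phi> k > 0"
      using pos that by simp
    then have "\<phi> (Suc k) / \<phi> k + \<phi> (k - 1) / \<phi> k = 2 - \<mu>"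
      using rec[of j] Suc by (simp add: add_divide_distrib[symmetric])
    then have "(1 - \<phi> (k - 1) / \<phi> k) + (1 - \<phi> (Suc k) / \<phi> k) = \<mu>"
      by simp
    then show ?thesis
      unfolding h_def g_def by (simp only: distrib_right[symmetric])
  qed
  have "\<mu> * (\<Sum>k<n. (norm (S k))\<^sup>2) = (\<Sum>k<n. h k + g k)"
    using coef by (simp add: sum_distrib_left)
  also have "\<dots> = (\<Sum>k<n. h k) + (\<Sum>k<n. g k)"
    by (rule sum.distrib)
  also have "(\<Sum>k<n. h k) = (\<Sum>k<n. h (Suc k))"
    using sum.lessThan_Suc_shift[of h n] by (simp add: h_def S0 Sn)
  also have "(\<Sum>k<n. h (Suc k)) + (\<Sum>k<n. g k) = (\<Sum>k<n. h (Suc k) + g k)"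
    by (rule sum.distrib[symmetric])
  also have "\<dots> \<le> (\<Sum>k<n. (norm (S (Suc k) - S k))\<^sup>2)"
    using step by (intro sum_mono) auto
  finally show ?thesis
    by (simp only: \<mu>_def)
qed

text \<open>The partial sums \<open>S\<close> of \<open>y\<close> vanish at both ends, so the inequality above bounds
  \<open>\<Sum> \<parallel>S k\<parallel>\<^sup>2\<close> by \<open>\<Sum> \<parallel>y k\<parallel>\<^sup>2\<close>, while summation by parts expresses \<open>\<Sum> \<parallel>y k\<parallel>\<^sup>2\<close> as a pairing of
  \<open>S\<close> with the differences of \<open>y\<close>. This duality exchanges the two boundary conditions without
  changing the constant.\<close>

lemma neumann_wirtinger_mean_zero:
  fixes y :: "nat \<Rightarrow> 'a::real_inner"
  assumes n: "n \<ge> 1" and mean: "(\<Sum>k<n. y k) = 0"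
  shows "4 * (sin (pi / (2 * real n)))\<^sup>2 * (\<Sum>k<n. (norm (y k))\<^sup>2)
           \<le> (\<Sum>k<n - 1. (norm (y (Suc k) - y k))\<^sup>2)"
proof -
  define \<mu> where "\<mu> = 4 * (sin (pi / (2 * real n)))\<^sup>2"
  define S where "S k = (\<Sum>i<k. y i)" for k
  obtain m where m: "n = Suc m"
    using n by (cases n) auto
  have S0: "S 0 = 0" and Sn: "S n = 0" and dS: "S (Suc k) - S k = y k" for k
    using mean by (simp_all add: S_def)
  have dirichlet: "\<mu> * (\<Sum>k<m. (norm (S (Suc k)))\<^sup>2) \<le> (\<Sum>k<n. (norm (y k))\<^sup>2)"
    using dirichlet_wirtinger[OF n S0 Sn]
    unfolding dS \<mu>_def m sum.lessThan_Suc_shift[of _ m] by (simp add: S0)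
  have parts: "(\<Sum>k<j. inner (S (Suc k)) (y (Suc k) - y k))
      = inner (S j) (y j) - (\<Sum>k<j. (norm (y k))\<^sup>2)" for j
    by (induction j)
      (simp_all add: S_def power2_norm_eq_inner inner_diff inner_add)
  have cross: "(\<Sum>k<m. inner (S (Suc k)) (y (Suc k) - y k)) = - (\<Sum>k<n. (norm (y k))\<^sup>2)"
  proof -
    have "S m = - y m"
      using Sn dS[of m] m by (metis diff_0 minus_minus)
    then show ?thesis
      unfolding parts by (simp add: m power2_norm_eq_inner)
  qed
  \<comment> \<open>In the extremal case the difference of \<open>y\<close> is \<open>- \<mu> S\<close>, so completing this square
    loses nothing.\<close>
  have "0 \<le> (\<Sum>k<m. (norm (y (Suc k) - y k + \<mu> *\<^sub>R S (Suc k)))\<^sup>2)"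
    by (intro sum_nonneg) simp
  also have "\<dots> = (\<Sum>k<m. (norm (y (Suc k) - y k))\<^sup>2
      + 2 * \<mu> * inner (S (Suc k)) (y (Suc k) - y k) + \<mu> * (\<mu> * (norm (S (Suc k)))\<^sup>2))"
    by (intro sum.cong refl)
      (simp add: power2_norm_eq_inner inner_add inner_diff inner_commute algebra_simps)
  also have "\<dots> = (\<Sum>k<m. (norm (y (Suc k) - y k))\<^sup>2) - 2 * \<mu> * (\<Sum>k<n. (norm (y k))\<^sup>2)
      + \<mu> * (\<mu> * (\<Sum>k<m. (norm (S (Suc k)))\<^sup>2))"
    unfolding sum.distrib sum_distrib_left[symmetric] cross by simp
  also have "\<dots> \<le> (\<Sum>k<m. (norm (y (Suc k) - y k))\<^sup>2) - 2 * \<mu> * (\<Sum>k<n. (norm (y k))\<^sup>2)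
      + \<mu> * (\<Sum>k<n. (norm (y k))\<^sup>2)"
    using mult_left_mono[OF dirichlet, of \<mu>] by (simp add: \<mu>_def)
  finally show ?thesis
    by (simp add: \<mu>_def m)
qed

lemma sum_norm_diff_mean:
  fixes y :: "nat \<Rightarrow> 'a::real_inner"
  assumes "n \<ge> 1"
  shows "(\<Sum>k<n. (norm (y k - (1 / real n) *\<^sub>R (\<Sum>i<n. y i)))\<^sup>2)
           = (\<Sum>k<n. (norm (y k))\<^sup>2) - (norm (\<Sum>k<n. y k))\<^sup>2 / real n"
proof -
  define Y where "Y = (\<Sum>i<n. y i)"
  have "(\<Sum>k<n. (norm (y k - (1 / real n) *\<^sub>R Y))\<^sup>2)
      = (\<Sum>k<n. (norm (y k))\<^sup>2 - 2 / real n * inner (y k) Y + (norm Y)\<^sup>2 / (real n * real n))"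
    by (intro sum.cong refl)
      (simp add: power2_norm_eq_inner inner_diff inner_commute)
  also have "\<dots> = (\<Sum>k<n. (norm (y k))\<^sup>2) - 2 / real n * inner Y Y
      + real n * ((norm Y)\<^sup>2 / (real n * real n))"
    by (simp only: sum.distrib sum_subtractf sum_distrib_left[symmetric]
        inner_sum_left[symmetric] Y_def[symmetric] sum_constant card_lessThan)
  also have "\<dots> = (\<Sum>k<n. (norm (y k))\<^sup>2) - (norm Y)\<^sup>2 / real n"
    using assms by (simp add: power2_norm_eq_inner[symmetric])
  finally show ?thesis
    by (simp add: Y_def)
qed

text \<open>Differences do not see a constant shift, so the mean may be subtracted first; what remains
  of the norms is the squared deviation from the mean.\<close>

lemma neumann_wirtinger:
  fixes y :: "nat \<Rightarrow> 'a::real_inner"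
  assumes n: "n \<ge> 1"
  shows "4 * (sin (pi / (2 * real n)))\<^sup>2
            * ((\<Sum>k<n. (norm (y k))\<^sup>2) - (norm (\<Sum>k<n. y k))\<^sup>2 / real n)
           \<le> (\<Sum>k<n - 1. (norm (y (Suc k) - y k))\<^sup>2)"
proof -
  define z where "z k = y k - (1 / real n) *\<^sub>R (\<Sum>i<n. y i)" for k
  have "(\<Sum>k<n. z k) = 0"
    using n by (simp add: z_def sum_subtractf scaleR_sum_right[symmetric] sum_constant_scaleR)
  from neumann_wirtinger_mean_zero[OF n this] show ?thesis
    by (simp add: z_def sum_norm_diff_mean[OF n])
qed

section \<open>Orthogonal projections\<close>

text \<open>By the parallelogram law the points of \<open>S\<close> whose squared distance to \<open>x\<close> is
  within \<open>1 / (n+1)\<close> of the infimum form closed sets \<open>C n\<close> shrinking to diameter zero, so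
  completeness yields a nearest point. At a nearest point no direction of \<open>S\<close> decreases the
  distance to first order, which is orthogonality.\<close>

lemma closed_subspace_orthogonal_point:
  fixes S :: "'a::{real_inner,complete_space} set"
  assumes sub: "subspace S" and "closed S"
  shows "\<exists>p. p \<in> S \<and> (\<forall>y\<in>S. inner (x - p) y = 0)"
proof -
  define d where "d = (INF y\<in>S. (norm (x - y))\<^sup>2)"
  define C where "C n = {y \<in> S. (norm (x - y))\<^sup>2 \<le> d + 1 / real (Suc n)}" for n
  have bdd: "bdd_below ((\<lambda>y. (norm (x - y))\<^sup>2) ` S)"
    by (rule bdd_belowI[of _ 0]) auto
  have d_le: "d \<le> (norm (x - y))\<^sup>2" if "y \<in> S" for y
    unfolding d_def using bdd that by (rule cINF_lower)
  have ne: "S \<noteq> {}"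
    using subspace_0[OF sub] by auto
  have close: "(norm (y - z))\<^sup>2 \<le> 4 / real (Suc n)" if "y \<in> C n" "z \<in> C n" for y z n
  proof -
    have "(1 / 2) *\<^sub>R (y + z) \<in> S"
      using that sub by (auto simp: C_def intro!: subspace_scale subspace_add)
    then have "d \<le> (norm (x - (1 / 2) *\<^sub>R (y + z)))\<^sup>2"
      by (rule d_le)
    moreover have "(norm (y - z))\<^sup>2 = 2 * (norm (x - y))\<^sup>2 + 2 * (norm (x - z))\<^sup>2
        - 4 * (norm (x - (1 / 2) *\<^sub>R (y + z)))\<^sup>2"
      by (simp add: power2_norm_eq_inner inner_diff inner_add inner_commute algebra_simps)
    ultimately show ?thesis
      using that by (simp add: C_def)
  qed
  obtain p where p: "\<And>n. p \<in> C n"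
  proof (rule decreasing_closed_nest[of C])
    show "closed (C n)" for n
    proof -
      have "C n = S \<inter> {y. (norm (x - y))\<^sup>2 \<le> d + 1 / real (Suc n)}"
        by (auto simp: C_def)
      moreover have "closed {y. (norm (x - y))\<^sup>2 \<le> d + 1 / real (Suc n)}"
        by (intro closed_Collect_le continuous_intros)
      ultimately show ?thesis
        using \<open>closed S\<close> by auto
    qed
    show "C n \<noteq> {}" for n
    proof -
      have "\<exists>y\<in>S. (norm (x - y))\<^sup>2 < d + 1 / real (Suc n)"
        using ne bdd by (subst cINF_less_iff[symmetric]) (auto simp: d_def)
      then show ?thesis
        by (auto simp: C_def intro: less_imp_le)
    qed
    show "C n \<subseteq> C m" if "m \<le> n" for m n
    proof -
      have "1 / real (Suc n) \<le> 1 / real (Suc m)"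
        using that by (intro divide_left_mono) auto
      then show ?thesis
        by (auto simp: C_def)
    qed
    show "\<exists>n. \<forall>y\<in>C n. \<forall>z\<in>C n. dist y z < e" if "e > 0" for e
    proof -
      have "e\<^sup>2 / 4 > 0"
        using that by simp
      then obtain n where n: "inverse (real (Suc n)) < e\<^sup>2 / 4"
        using reals_Archimedean by blast
      have "dist y z < e" if "y \<in> C n" "z \<in> C n" for y z
      proof -
        have "(dist y z)\<^sup>2 < e\<^sup>2"
          using close[OF that] n by (simp add: dist_norm inverse_eq_divide)
        then show ?thesis
          using \<open>e > 0\<close> by (simp add: power2_less_imp_less)
      qed
      then show ?thesis
        by blast
    qed
  qed blast
  have pS: "p \<in> S"
    using p by (simp add: C_def)
  have min: "(norm (x - p))\<^sup>2 \<le> d"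
  proof (rule field_le_epsilon)
    fix e :: real
    assume "e > 0"
    then obtain n where "inverse (real (Suc n)) < e"
      using reals_Archimedean by blast
    then show "(norm (x - p))\<^sup>2 \<le> d + e"
      using p[of n] by (simp add: C_def inverse_eq_divide)
  qed
  have "inner (x - p) y = 0" if y: "y \<in> S" for y
  proof (rule ccontr)
    assume ip: "inner (x - p) y \<noteq> 0"
    then have y0: "inner y y > 0"
      by auto
    \<comment> \<open>\<open>t y\<close> is the component of \<open>x - p\<close> along \<open>y\<close>, so adding it to \<open>p\<close> is the best move in
      that direction.\<close>
    define t where "t = inner (x - p) y / inner y y"
    have "p + t *\<^sub>R y \<in> S"
      using sub pS y by (intro subspace_add subspace_scale)
    then have "(norm (x - p))\<^sup>2 \<le> (norm (x - (p + t *\<^sub>R y)))\<^sup>2"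
      using min d_le by (meson order_trans)
    also have "x - (p + t *\<^sub>R y) = (x - p) - t *\<^sub>R y"
      by simp
    also have "(norm ((x - p) - t *\<^sub>R y))\<^sup>2
        = (norm (x - p))\<^sup>2 - 2 * t * inner (x - p) y + t * t * inner y y"
      unfolding power2_norm_eq_inner inner_diff_left[of "x - p"] inner_diff_right[of _ "x - p"]
      by (simp add: inner_commute)
    also have "\<dots> = (norm (x - p))\<^sup>2 - (inner (x - p) y)\<^sup>2 / inner y y"
      using y0 by (simp add: t_def power2_eq_square)
    finally show False
      using ip y0 by (simp add: divide_le_0_iff)
  qed
  with pS show ?thesis
    by blast
qed

lemma complex_subspace_imp_subspace:
  fixes S :: "'a::complex_hilbert_space set"
  assumes "complex_vector.subspace S"
  shows "subspace S"
  using assms unfolding subspace_def complex_vector.subspace_def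
  by (metis scaleC_of_real)

text \<open>The imaginary part of \<open>cinner x y\<close> is the real inner product of \<open>x\<close> with \<open>\<i> y\<close>, which again
  lies in \<open>S\<close>. This allows all later orthogonality arguments to use the real inner product.\<close>

lemma cinner_orthogonal_iff:
  fixes S :: "'a::complex_hilbert_space set"
  assumes S: "complex_vector.subspace S"
  shows "(\<forall>y\<in>S. cinner x y = 0) \<longleftrightarrow> (\<forall>y\<in>S. inner x y = 0)"
proof (intro iffI ballI)
  fix y
  assume "\<forall>y\<in>S. cinner x y = 0" "y \<in> S"
  then show "inner x y = 0"
    by (simp add: Re_cinner[symmetric])
next
  fix y
  assume orth: "\<forall>y\<in>S. inner x y = 0" and y: "y \<in> S"
  have "scaleC \<i> y \<in> S"
    using S y by (rule complex_vector.subspace_scale)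
  then have "Re (cinner x (scaleC \<i> y)) = 0"
    using orth by (simp add: Re_cinner)
  moreover have "cinner x (scaleC \<i> y) = cnj \<i> * cinner x y"
    by (metis cinner_commute cinner_scaleC_left complex_cnj_mult)
  moreover have "Re (cinner x y) = 0"
    using orth y by (simp add: Re_cinner)
  ultimately show "cinner x y = 0"
    by (simp add: complex_eq_iff)
qed

lemma orth_proj:
  fixes S :: "'a::complex_hilbert_space set"
  assumes "closed_csubspace S"
  shows orth_proj_in: "orth_proj S x \<in> S"
    and orth_proj_orthogonal: "y \<in> S \<Longrightarrow> inner (x - orth_proj S x) y = 0"
proof -
  have S: "complex_vector.subspace S" "subspace S" "closed S"
    using assms complex_subspace_imp_subspace by (auto simp: closed_csubspace_def)
  let ?P = "\<lambda>p. p \<in> S \<and> (\<forall>y\<in>S. inner (x - p) y = 0)"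
  obtain p where p: "?P p"
    using closed_subspace_orthogonal_point[OF S(2,3)] by metis
  have uniq: "q = p" if q: "?P q" for q
  proof -
    have "q - p \<in> S"
      using p q S(2) by (simp add: subspace_diff)
    then have "inner (x - p) (q - p) = 0" "inner (x - q) (q - p) = 0"
      using p q by blast+
    then have "inner (q - p) (q - p) = 0"
      by (simp add: inner_diff)
    then show ?thesis
      by simp
  qed
  have "orth_proj S x = p"
    unfolding orth_proj_def cinner_orthogonal_iff[OF S(1)] using p by (rule the_equality) (rule uniq)
  then show "orth_proj S x \<in> S" and "y \<in> S \<Longrightarrow> inner (x - orth_proj S x) y = 0"
    using p by auto
qed

lemma norm_orth_proj_pythagoras:
  fixes S :: "'a::complex_hilbert_space set"
  assumes "closed_csubspace S" "w \<in> S"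
  shows "(norm (x - w))\<^sup>2 = (norm (orth_proj S x - w))\<^sup>2 + (norm (x - orth_proj S x))\<^sup>2"
proof -
  have "inner (x - orth_proj S x) (orth_proj S x) = 0" "inner (x - orth_proj S x) w = 0"
    using assms orth_proj by blast+
  then show ?thesis
    by (simp add: power2_norm_eq_inner inner_diff inner_commute algebra_simps)
qed

lemma closed_csubspace_Hcap:
  assumes "\<forall>i\<in>{1..n}. closed_csubspace (H i)"
  shows "closed_csubspace (Hcap n H)"
  using assms unfolding closed_csubspace_def Hcap_def complex_vector.subspace_def
  by (auto intro!: closed_INT)

section \<open>The Friedrichs number\<close>

lemma norm_sum_squared_pairs:
  fixes x :: "nat \<Rightarrow> 'a::complex_hilbert_space"
  shows "2 * (\<Sum>(i, j)\<in>{(i, j). 1 \<le> i \<and> i < j \<and> j \<le> n}. Re (cinner (x i) (x j)))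
           = (norm (\<Sum>i=1..n. x i))\<^sup>2 - (\<Sum>i=1..n. (norm (x i))\<^sup>2)"
proof (induction n)
  case 0
  have "{(i, j). 1 \<le> i \<and> i < j \<and> j \<le> (0::nat)} = {}"
    by auto
  then show ?case
    by (simp only:) simp
next
  case (Suc n)
  let ?P = "\<lambda>n::nat. {(i, j). 1 \<le> i \<and> i < j \<and> j \<le> n}"
  have fin: "finite (?P n)"
    by (rule finite_subset[of _ "{1..n} \<times> {1..n}"]) auto
  have "?P (Suc n) = ?P n \<union> (\<lambda>i. (i, Suc n)) ` {1..n}"
    by (auto simp: le_Suc_eq)
  then have "(\<Sum>(i, j)\<in>?P (Suc n). Re (cinner (x i) (x j)))
      = (\<Sum>(i, j)\<in>?P n. Re (cinner (x i) (x j)))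
        + (\<Sum>(i, j)\<in>(\<lambda>i. (i, Suc n)) ` {1..n}. Re (cinner (x i) (x j)))"
    using fin by (simp only:) (rule sum.union_disjoint, auto)
  also have "(\<Sum>(i, j)\<in>(\<lambda>i. (i, Suc n)) ` {1..n}. Re (cinner (x i) (x j)))
      = inner (\<Sum>i=1..n. x i) (x (Suc n))"
    by (subst sum.reindex) (auto simp: inj_on_def Re_cinner inner_sum_left)
  finally show ?case
    using Suc.IH
    by (simp add: power2_norm_eq_inner inner_add inner_commute algebra_simps)
qed

text \<open>The pair sum in the Friedrichs number is half of \<open>\<parallel>\<Sum> x i\<parallel>\<^sup>2 - \<Sum> \<parallel>x i\<parallel>\<^sup>2\<close>, so a bound on the
  quotient is a bound on the length of the sum. The quotients never exceed 1, because the
  squared deviation of the system from its mean is nonnegative; this makes the supremum an upper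
  bound.\<close>

lemma norm_sum_le_friedrichs_number:
  fixes H :: "nat \<Rightarrow> 'a::complex_hilbert_space set"
  assumes n: "n \<ge> 2" and x: "\<And>i. i \<in> {1..n} \<Longrightarrow> x i \<in> H i \<ominus> Hcap n H"
  shows "(norm (\<Sum>i=1..n. x i))\<^sup>2
           \<le> (1 + (real n - 1) * friedrichs_number n H) * (\<Sum>i=1..n. (norm (x i))\<^sup>2)"
proof (cases "\<exists>i\<in>{1..n}. x i \<noteq> 0")
  case False
  then show ?thesis
    by simp
next
  case True
  let ?q = "\<lambda>x. 2 / (real n - 1) *
       ((\<Sum>(i, j)\<in>{(i, j). 1 \<le> i \<and> i < j \<and> j \<le> n}. Re (cinner (x i) (x j)))
        / (\<Sum>i=1..n. (norm (x i))\<^sup>2))"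
  have pos: "(\<Sum>i=1..n. (norm (z i))\<^sup>2) > 0" if "\<exists>i\<in>{1..n}. z i \<noteq> 0" for z :: "nat \<Rightarrow> 'a"
    using that by (auto intro!: sum_pos2)
  have q: "?q z * (real n - 1) * (\<Sum>i=1..n. (norm (z i))\<^sup>2)
      = (norm (\<Sum>i=1..n. z i))\<^sup>2 - (\<Sum>i=1..n. (norm (z i))\<^sup>2)"
    if "\<exists>i\<in>{1..n}. z i \<noteq> 0" for z :: "nat \<Rightarrow> 'a"
    unfolding norm_sum_squared_pairs[symmetric] using pos[OF that] n by simp
  have "?q z \<le> 1" if z: "\<exists>i\<in>{1..n}. z i \<noteq> 0" for z :: "nat \<Rightarrow> 'a"
  proof -
    have "0 \<le> (\<Sum>k<n. (norm (z (Suc k)))\<^sup>2) - (norm (\<Sum>k<n. z (Suc k)))\<^sup>2 / real n"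
      using n by (subst sum_norm_diff_mean[symmetric]) (auto intro!: sum_nonneg)
    then have "(norm (\<Sum>i=1..n. z i))\<^sup>2 \<le> real n * (\<Sum>i=1..n. (norm (z i))\<^sup>2)"
      using n by (simp add: sum.atLeast1_atMost_eq field_simps)
    then have "?q z * ((real n - 1) * (\<Sum>i=1..n. (norm (z i))\<^sup>2))
        \<le> 1 * ((real n - 1) * (\<Sum>i=1..n. (norm (z i))\<^sup>2))"
      using q[OF z] by (simp add: algebra_simps)
    then show ?thesis
      by (rule mult_right_le_imp_le) (use pos[OF z] n in simp)
  qed
  then have bdd: "bdd_above (friedrichs_set n H)"
    unfolding friedrichs_set_def by (intro bdd_aboveI[of _ 1]) blast
  have mem: "?q x \<in> friedrichs_set n H"
    unfolding friedrichs_set_def using x True by blast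
  have "?q x \<le> friedrichs_number n H"
    using cSup_upper[OF mem bdd] mem by (auto simp: friedrichs_number_def)
  then have "?q x * ((real n - 1) * (\<Sum>i=1..n. (norm (x i))\<^sup>2))
      \<le> friedrichs_number n H * ((real n - 1) * (\<Sum>i=1..n. (norm (x i))\<^sup>2))"
    by (rule mult_right_mono) (use pos[OF True] n in simp)
  then show ?thesis
    using q[OF True] by (simp add: algebra_simps)
qed

section \<open>The product of the projections\<close>

text \<open>All \<open>X k\<close> are shifted by the same \<open>p\<close>, which lies in every \<open>H i\<close> and is fixed by every
  projection; hence the shifted sequence is again a sequence of successive projections, now in
  the orthogonal complement of the intersection.\<close>

lemma proj_product_bound:
  fixes H :: "nat \<Rightarrow> 'a::complex_hilbert_space set"
  assumes n: "n \<ge> 2" and H: "\<forall>i\<in>{1..n}. closed_csubspace (H i)"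
    and c: "friedrichs_number n H \<le> c" "c \<le> 1"
  shows "(1 + 4 * (real n - 1) * (sin (pi / (2 * real n)))\<^sup>2 * (1 - c))
            * (norm (proj_product H n x - orth_proj (Hcap n H) x))\<^sup>2 \<le> (norm x)\<^sup>2"
proof -
  define \<mu> where "\<mu> = 4 * (sin (pi / (2 * real n)))\<^sup>2"
  define p where "p = orth_proj (Hcap n H) x"
  define X where "X k = proj_product H k x - p" for k
  define N where "N = (\<Sum>i=1..n. (norm (X i))\<^sup>2)"
  have H0: "closed_csubspace (Hcap n H)"
    using H by (rule closed_csubspace_Hcap)
  have p: "p \<in> Hcap n H"
    unfolding p_def using H0 by (rule orth_proj_in)
  have sub: "Hcap n H \<subseteq> H i" if "i \<in> {1..n}" for i
    using that by (auto simp: Hcap_def)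
  have \<mu>: "\<mu> \<ge> 0"
    by (simp add: \<mu>_def)
  have pyth: "(norm (X k))\<^sup>2 = (norm (X (Suc k)))\<^sup>2 + (norm (X (Suc k) - X k))\<^sup>2"
    if "k < n" for k
  proof -
    have "Suc k \<in> {1..n}"
      using that by auto
    then show ?thesis
      using norm_orth_proj_pythagoras[of "H (Suc k)" p "proj_product H k x"] H p sub
      by (auto simp: X_def norm_minus_commute)
  qed
  have orth: "inner (X k) y = 0" if "k \<le> n" "y \<in> Hcap n H" for k y
    using that(1)
  proof (induction k)
    case 0
    show ?case
      using orth_proj_orthogonal[OF H0 that(2)] by (simp add: X_def p_def)
  next
    case (Suc k)
    then have k: "Suc k \<in> {1..n}"
      by auto
    have "inner (proj_product H k x - orth_proj (H (Suc k)) (proj_product H k x)) y = 0"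
      using orth_proj_orthogonal[of "H (Suc k)"] H k sub that(2) by blast
    then show ?case
      using Suc by (simp add: X_def inner_diff)
  qed
  have X: "X i \<in> H i \<ominus> Hcap n H" if i: "i \<in> {1..n}" for i
  proof -
    have Hi: "closed_csubspace (H i)"
      using H i by blast
    obtain k where k: "i = Suc k"
      using i by (cases i) auto
    have "proj_product H i x \<in> H i"
      using orth_proj_in[OF Hi] by (simp add: k)
    moreover have "p \<in> H i"
      using p sub i by blast
    ultimately have "X i \<in> H i"
      unfolding X_def using Hi complex_subspace_imp_subspace
      by (auto simp: closed_csubspace_def intro: subspace_diff)
    moreover have "\<forall>y\<in>Hcap n H. cinner (X i) y = 0"
      using orth i H0 by (subst cinner_orthogonal_iff) (auto simp: closed_csubspace_def)
    ultimately show ?thesis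
      by (simp add: ominus_def)
  qed
  have tele: "(norm (X 0))\<^sup>2 = (norm (X k))\<^sup>2 + (\<Sum>i<k. (norm (X (Suc i) - X i))\<^sup>2)"
    if "k \<le> n" for k
    using that by (induction k) (simp_all add: pyth)
  have N_ge: "real n * (norm (X n))\<^sup>2 \<le> N"
  proof -
    have "(norm (X n))\<^sup>2 \<le> (norm (X i))\<^sup>2" if "i \<le> n" for i
      using that
    proof (induction i rule: inc_induct)
      case (step k)
      then show ?case
        using pyth[of k] zero_le_power2[of "norm (X (Suc k) - X k)"] by linarith
    qed simp
    then have "(\<Sum>i=1..n. (norm (X n))\<^sup>2) \<le> N"
      unfolding N_def by (intro sum_mono) auto
    then show ?thesis
      by simp
  qed
  have F: "(norm (\<Sum>i=1..n. X i))\<^sup>2 \<le> (1 + (real n - 1) * c) * N"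
  proof -
    have "(norm (\<Sum>i=1..n. X i))\<^sup>2 \<le> (1 + (real n - 1) * friedrichs_number n H) * N"
      unfolding N_def using n X by (rule norm_sum_le_friedrichs_number)
    also have "\<dots> \<le> (1 + (real n - 1) * c) * N"
      using n c by (intro mult_right_mono add_left_mono mult_left_mono)
        (auto simp: N_def intro: sum_nonneg)
    finally show ?thesis .
  qed
  \<comment> \<open>The deviation from the mean is \<open>N - \<parallel>\<Sum> X i\<parallel>\<^sup>2 / n\<close>.\<close>
  have "(real n - 1) * (1 - c) * (norm (X n))\<^sup>2
      = (real n - 1) * (1 - c) / real n * (real n * (norm (X n))\<^sup>2)"
    using n by simp
  also have "\<dots> \<le> (real n - 1) * (1 - c) / real n * N"
    using N_ge n c by (intro mult_left_mono) auto
  also have "\<dots> = N - (1 + (real n - 1) * c) * N / real n"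
    using n by (simp add: field_simps)
  also have "\<dots> \<le> N - (norm (\<Sum>i=1..n. X i))\<^sup>2 / real n"
    using F n by (simp add: divide_right_mono)
  finally have "\<mu> * ((real n - 1) * (1 - c) * (norm (X n))\<^sup>2)
      \<le> \<mu> * (N - (norm (\<Sum>i=1..n. X i))\<^sup>2 / real n)"
    using \<mu> by (rule mult_left_mono)
  \<comment> \<open>The path consists of \<open>X 1, \<dots>, X n\<close> only: \<open>X 0\<close> lies in no \<open>H i\<close> in general, and the
    first step is dropped.\<close>
  also have "\<dots> \<le> (\<Sum>k<n - 1. (norm (X (Suc (Suc k)) - X (Suc k)))\<^sup>2)"
    using neumann_wirtinger[of n "\<lambda>k. X (Suc k)"] n
    by (simp add: N_def \<mu>_def sum.atLeast1_atMost_eq)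
  also have "\<dots> \<le> (\<Sum>k<n. (norm (X (Suc k) - X k))\<^sup>2)"
    using n sum.lessThan_Suc_shift[of "\<lambda>k. (norm (X (Suc k) - X k))\<^sup>2" "n - 1"] by simp
  finally have "(norm (X n))\<^sup>2 + \<mu> * ((real n - 1) * (1 - c) * (norm (X n))\<^sup>2) \<le> (norm (X 0))\<^sup>2"
    using tele[of n] by simp
  also have "(norm (X 0))\<^sup>2 \<le> (norm x)\<^sup>2"
  proof -
    have "0 \<in> Hcap n H"
      using H0 complex_vector.subspace_0 by (auto simp: closed_csubspace_def)
    then show ?thesis
      using norm_orth_proj_pythagoras[OF H0, of 0 x] by (simp add: X_def p_def)
  qed
  finally show ?thesis
    by (simp add: X_def p_def \<mu>_def algebra_simps)
qed

lemma Hcap_UNIV: "Hcap n (\<lambda>_. UNIV) = UNIV"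
  by (simp add: Hcap_def)

text \<open>This system is admissible for every \<open>c \<ge> 0\<close>, so the supremum defining \<open>friedrichs_f\<close> is
  taken over a nonempty set; otherwise its value would be arbitrary.\<close>

lemma friedrichs_number_UNIV:
  "friedrichs_number n (\<lambda>_. UNIV :: 'a::complex_hilbert_space set) = 0"
proof -
  have "x = 0" if "x \<in> UNIV \<ominus> UNIV" for x :: 'a
  proof -
    have "inner x x = 0"
      using that by (simp add: ominus_def Re_cinner[symmetric])
    then show ?thesis
      by simp
  qed
  then have "friedrichs_set n (\<lambda>_. UNIV :: 'a set) = {}"
    unfolding friedrichs_set_def Hcap_UNIV by blast
  then show ?thesis
    by (simp add: friedrichs_number_def)
qed

text \<open>After squaring and clearing the denominator, the difference of the two sides is \<open>t\<^sup>3\<close> times a quadratic polynomial in \<open>t\<close>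
  with negative discriminant.\<close>

lemma inverse_sqrt_le_taylor2:
  fixes t :: real
  assumes "t \<ge> 0"
  shows "1 / sqrt (1 + 2 * t) \<le> 1 - t + 3 / 2 * t\<^sup>2"
proof -
  let ?q = "1 - t + 3 / 2 * t\<^sup>2"
  have q: "?q > 0"
  proof -
    have "?q = 3 / 2 * (t - 1 / 3)\<^sup>2 + 5 / 6"
      by (simp add: power2_eq_square algebra_simps)
    then show ?thesis
      using zero_le_power2[of "t - 1 / 3"] by linarith
  qed
  have "?q\<^sup>2 * (1 + 2 * t) = 1 + t ^ 3 * (9 / 2 * (t - 5 / 12)\<^sup>2 + 135 / 32)"
    by (simp add: power2_eq_square power3_eq_cube algebra_simps)
  then have "1 \<le> ?q\<^sup>2 * (1 + 2 * t)"
    using assms by simp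
  then have "1 \<le> sqrt (?q\<^sup>2 * (1 + 2 * t))"
    by simp
  also have "\<dots> = ?q * sqrt (1 + 2 * t)"
    using q by (simp add: real_sqrt_mult)
  finally show ?thesis
    using assms by (simp add: divide_le_eq)
qed

theorem mainTheorem4:
  fixes n :: nat and c :: real
  assumes "n \<ge> 2" and "c \<in> {0..1}"
  shows "friedrichs_f TYPE('a::complex_hilbert_space) n c
           \<le> 1 / sqrt (1 + 4 * (real n - 1) * (sin (pi / (2 * real n)))\<^sup>2 * (1 - c))
       \<and> 1 / sqrt (1 + 4 * (real n - 1) * (sin (pi / (2 * real n)))\<^sup>2 * (1 - c))
           \<le> 1 - coeff_a n * (1 - c) + coeff_b n * (1 - c)\<^sup>2"
proof
  let ?s = "(sin (pi / (2 * real n)))\<^sup>2"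
  define K where "K = 1 + 4 * (real n - 1) * ?s * (1 - c)"
  have K: "K > 0"
    unfolding K_def using assms by (intro add_pos_nonneg mult_nonneg_nonneg) auto
  show "friedrichs_f TYPE('a) n c \<le> 1 / sqrt (1 + 4 * (real n - 1) * ?s * (1 - c))"
    unfolding K_def[symmetric] friedrichs_f_def
  proof (rule cSup_least)
    have "closed_csubspace (UNIV :: 'a set)"
      by (simp add: closed_csubspace_def complex_vector.subspace_def)
    then show "{onorm (\<lambda>x. proj_product H n x - orth_proj (Hcap n H) x) | H :: nat \<Rightarrow> 'a set.
        (\<forall>i\<in>{1..n}. closed_csubspace (H i)) \<and> friedrichs_number n H \<le> c} \<noteq> {}"
      using assms(2) friedrichs_number_UNIV[where ?'a = 'a and n = n] by fastforce
  next
    fix r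
    assume "r \<in> {onorm (\<lambda>x. proj_product H n x - orth_proj (Hcap n H) x) | H :: nat \<Rightarrow> 'a set.
        (\<forall>i\<in>{1..n}. closed_csubspace (H i)) \<and> friedrichs_number n H \<le> c}"
    then obtain H :: "nat \<Rightarrow> 'a set"
      where r: "r = onorm (\<lambda>x. proj_product H n x - orth_proj (Hcap n H) x)"
        and H: "\<forall>i\<in>{1..n}. closed_csubspace (H i)" "friedrichs_number n H \<le> c"
      by blast
    show "r \<le> 1 / sqrt K"
      unfolding r
    proof (rule onorm_bound)
      fix x
      let ?T = "norm (proj_product H n x - orth_proj (Hcap n H) x)"
      have "K * ?T\<^sup>2 \<le> (norm x)\<^sup>2"
        unfolding K_def using assms H by (intro proj_product_bound) auto
      then have "sqrt (K * ?T\<^sup>2) \<le> norm x"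
        by (intro real_le_lsqrt) auto
      then show "?T \<le> 1 / sqrt K * norm x"
        using K by (simp add: real_sqrt_mult pos_le_divide_eq mult.commute)
    qed (use K in simp)
  qed
  have "coeff_a n * (1 - c) \<ge> 0"
    using assms by (simp add: coeff_a_def)
  from inverse_sqrt_le_taylor2[OF this]
  show "1 / sqrt (1 + 4 * (real n - 1) * ?s * (1 - c)) \<le> 1 - coeff_a n * (1 - c) + coeff_b n * (1 - c)\<^sup>2"
    by (simp add: coeff_a_def coeff_b_def power2_eq_square power4_eq_xxxx algebra_simps)
qed

end
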